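(* Let $X$ be a Hilbert space, $x_0\in X$ and $K_l\subset X$ be nonempty closed convex sets for $l\in\{1,\dots,r\}$ with $\bigcap_{l=1}^rK_l=\emptyset$. Suppose the BAP algorithm with aggregation of constraints (described in the context) is run and produces an infinite sequence of iterates $\{x_i\}$. Then the sequence $\{x_i\}$ cannot have a strong cluster point. If $X=\mathbb{R}^n$, the sequence $\{\|x_i-x_0\|\}_i$ must be monotonically increasing to infinity.
   Context: A strong cluster point is a cluster point in the norm topology. $P_C$ denotes projection onto the closed convex set $C$. BAP algorithm with aggregation: the algorithm maintains polyhedra, each described by finitely many linear inequalities and each containing $\bigcap_{l=1}^r K_l$, starting with the whole space $X$ (no constraints) and the point $x_0$. At iteration $i$, $x_i$ is the projection of $x_0$ onto the current polyhedron. (1) Aggregation: the current polyhedron may be replaced by a larger one, by replacing groups of its constraints $\langle a_j,x\rangle\le b_j$, $j\in J$, by the single constraint $\big\langle\sum_{j\in J}\lambda_ja_j,x\big\rangle\le\sum_{j\in J}\lambda_jb_j$ for some multipliers $\lambda_j\ge0$; this is done so that $x_i$ is still the projection of $x_0$ onto the new polyhedron. (2) Halfspaces obtained by projecting $x_i$ onto some of the $K_l$ are intersected with the stored polyhedron; here the halfspace obtained by projecting $x_i$ onto $K_l$ is $\{x:\langle x_i-P_{K_l}(x_i),x\rangle\le\langle x_i-P_{K_l}(x_i),P_{K_l}(x_i)\rangle\}$. One of these halfspaces is obtained by projecting $x_i$ onto a set $K_{l_i^*}$ for which $d(x_i,K_{l_i^*})=\max_{l\in\{1,\dots,r\}}d(x_i,K_l)$.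 The next iterate $x_{i+1}$ is the projection of $x_0$ onto this new polyhedron (the algorithm stops if this polyhedron is empty). *)

theory Defs
  imports "HOL-Analysis.Analysis"
begin

text \<open>The library's \<open>closest_point\<close> is confined to Heine-Borel spaces; this is the
  nearest-point projection \<open>P\<^sub>C\<close> in an arbitrary real inner product space. In a Hilbert space the
  nearest point exists and is unique whenever \<open>C\<close> is nonempty, closed and convex.\<close>

definition metric_proj :: "'a::real_inner set \<Rightarrow> 'a \<Rightarrow> 'a" where
  "metric_proj C z = (THE p. p \<in> C \<and> (\<forall>y\<in>C. dist z p \<le> dist z y))"

text \<open>A linear constraint \<open>\<langle>a, x\<rangle> \<le> b\<close> is encoded as the pair \<open>(a, b)\<close>. The empty set of constraints
  describes the whole space.\<close>

type_synonym 'a constraint = "'a \<times> real"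

definition feasible :: "'a::real_inner constraint set \<Rightarrow> 'a set" where
  "feasible C = {x. \<forall>(a, b)\<in>C. a \<bullet> x \<le> b}"

definition aggregate :: "'a::real_inner constraint set \<Rightarrow> ('a constraint \<Rightarrow> real) \<Rightarrow> 'a constraint" where
  "aggregate J w = (\<Sum>j\<in>J. w j *\<^sub>R fst j, \<Sum>j\<in>J. w j * snd j)"

text \<open>Each element of \<open>G\<close> is a group of constraints together with its multipliers; all groups are
  replaced simultaneously, constraints outside every group are kept, and \<open>G = {}\<close> means that
  nothing is aggregated. Groups may overlap.\<close>

definition aggregates_to :: "'a::real_inner constraint set \<Rightarrow> 'a constraint set \<Rightarrow> bool" where
  "aggregates_to C C' \<longleftrightarrow>
     (\<exists>G. finite G \<and>
          (\<forall>(J, w)\<in>G. J \<noteq> {} \<and> J \<subseteq> C \<and> (\<forall>j\<in>J. 0 \<le> w j)) \<and>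
          C' = (C - (\<Union>(J, w)\<in>G. J)) \<union> (\<lambda>(J, w). aggregate J w) ` G)"

definition proj_constraint :: "'a::real_inner set \<Rightarrow> 'a \<Rightarrow> 'a constraint" where
  "proj_constraint S z =
     (z - metric_proj S z, (z - metric_proj S z) \<bullet> metric_proj S z)"

text \<open>An infinite run with iterates \<open>x\<close>. \<open>C i\<close> are the constraints stored on reaching \<open>x i\<close>,
  \<open>C' i\<close> those after the (optional) aggregation at iteration \<open>i\<close>, and \<open>L\<close> the indices of the sets
  projected onto at iteration \<open>i\<close>. Since each step is the intersection with finitely many
  halfspaces containing some \<open>K l\<close>, or an aggregation, the stored constraint sets are
  automatically finite and their polyhedra automatically contain \<open>\<Inter>l\<in>{1..r}. K l\<close>.\<close>

definition bap_run ::
  "nat \<Rightarrow> (nat \<Rightarrow> 'a::real_inner set) \<Rightarrow> 'a \<Rightarrow> (nat \<Rightarrow> 'a) \<Rightarrow> bool" where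
  "bap_run r K x0 x \<longleftrightarrow>
     (\<exists>C C'. C 0 = {} \<and> x 0 = x0 \<and>
        (\<forall>i. aggregates_to (C i) (C' i) \<and>
             x i = metric_proj (feasible (C' i)) x0 \<and>
             (\<exists>L. L \<subseteq> {1..r} \<and>
                  (\<exists>l\<in>L. infdist (x i) (K l) = Max ((\<lambda>l. infdist (x i) (K l)) ` {1..r})) \<and>
                  C (Suc i) = C' i \<union> (\<lambda>l. proj_constraint (K l) (x i)) ` L) \<and>
             feasible (C (Suc i)) \<noteq> {} \<and>
             x (Suc i) = metric_proj (feasible (C (Suc i))) x0))"

definition strong_cluster_point :: "(nat \<Rightarrow> 'a::real_normed_vector) \<Rightarrow> 'a \<Rightarrow> bool" where
  "strong_cluster_point x z \<longleftrightarrow>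
     (\<forall>U. open U \<and> z \<in> U \<longrightarrow> (\<exists>\<^sub>F i in sequentially. x i \<in> U))"

end

theory Submission
  imports Defs
begin

text \<open>
  The iterates are successive projections of \<open>x0\<close> onto closed convex polyhedra. Aggregation
  keeps \<open>x i\<close> as the projection of \<open>x0\<close>, and the new halfspaces only shrink the aggregated
  polyhedron, so \<open>x (Suc i)\<close> lies in the polyhedron onto which \<open>x i\<close> is a projection. The obtuse-angle
  property of projections then gives the Pythagorean inequality
  \<open>\<parallel>x i - x0\<parallel>\<^sup>2 + \<parallel>x (Suc i) - x i\<parallel>\<^sup>2 \<le> \<parallel>x (Suc i) - x0\<parallel>\<^sup>2\<close> (\<open>bap_run_pythagoras\<close>). On the other
  hand \<open>x (Suc i)\<close> lies in the halfspace that separates \<open>x i\<close> from a most distant \<open>K l\<close>, so the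
  step length \<open>\<parallel>x (Suc i) - x i\<parallel>\<close> bounds the distance from \<open>x i\<close> to every \<open>K l\<close>
  (\<open>bap_run_infdist_le_step\<close>).

  A cluster point \<open>z\<close> would keep the nondecreasing sequence \<open>\<parallel>x i - x0\<parallel>\<close> bounded, hence convergent;
  by the Pythagorean inequality the steps tend to \<open>0\<close>, and so do the distances of \<open>x i\<close> to all the
  sets. By continuity \<open>z\<close> belongs to every \<open>K l\<close>, which contradicts the empty intersection. A step of
  length \<open>0\<close> gives the same contradiction with \<open>x i\<close> in place of \<open>z\<close>, whence strict monotonicity.
  In finite dimension, norms that do not tend to infinity are bounded, and a bounded sequence has a
  cluster point.
\<close>

section \<open>Projections in Hilbert spaces\<close>

lemma parallelogram_law:
  fixes a b :: "'a::real_inner"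
  shows "(norm (a - b))\<^sup>2 = 2 * (norm a)\<^sup>2 + 2 * (norm b)\<^sup>2 - (norm (a + b))\<^sup>2"
  by (simp add: power2_norm_eq_inner inner_diff_left inner_diff_right inner_add_left inner_add_right)

text \<open>The sets \<open>C \<inter> cball z (d + \<epsilon>)\<close>, with \<open>d\<close> the distance from \<open>z\<close> to \<open>C\<close>, are nested,
  nonempty and closed. Convexity puts midpoints in \<open>C\<close>, so the parallelogram law bounds their
  diameters by a quantity that vanishes with \<open>\<epsilon>\<close>; completeness supplies a common point.\<close>

lemma nearest_point_exists:
  fixes C :: "'a::{real_inner, complete_space} set"
  assumes "closed C" "convex C" "C \<noteq> {}"
  shows "\<exists>p\<in>C. \<forall>y\<in>C. dist z p \<le> dist z y"
proof -
  define d where "d = infdist z C"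
  have d0: "0 \<le> d" unfolding d_def by (rule infdist_nonneg)
  have dle: "d \<le> dist z y" if "y \<in> C" for y
    unfolding d_def using that by (rule infdist_le)
  define S where "S n = C \<inter> cball z (d + 1 / real (Suc n))" for n
  have diam: "(dist u v)\<^sup>2 \<le> 4 * (2 * d + 1) * e"
    if u: "u \<in> C" "dist z u \<le> d + e" and v: "v \<in> C" "dist z v \<le> d + e" and e: "0 < e" "e \<le> 1"
    for u v e
  proof -
    have "midpoint u v \<in> C"
      using convexD[OF \<open>convex C\<close> u(1) v(1), of "1 / 2" "1 / 2"]
      by (simp add: midpoint_def scaleR_add_right)
    then have mid: "d\<^sup>2 \<le> (dist z (midpoint u v))\<^sup>2"
      using dle d0 by (intro power_mono) auto
    have "(z - u) + (z - v) = 2 *\<^sub>R (z - midpoint u v)"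
      by (simp add: midpoint_def scaleR_diff_right scaleR_2)
    then have "norm ((z - u) + (z - v)) = 2 * dist z (midpoint u v)"
      by (simp add: dist_norm)
    moreover have "dist u v = norm ((z - u) - (z - v))"
      by (simp add: dist_norm norm_minus_commute)
    ultimately have parallelogram:
      "(dist u v)\<^sup>2 = 2 * (dist z u)\<^sup>2 + 2 * (dist z v)\<^sup>2 - 4 * (dist z (midpoint u v))\<^sup>2"
      using parallelogram_law[of "z - u" "z - v"] by (simp add: dist_norm power_mult_distrib)
    have "(dist z u)\<^sup>2 \<le> (d + e)\<^sup>2" "(dist z v)\<^sup>2 \<le> (d + e)\<^sup>2"
      using u v by (auto intro!: power_mono)
    then have "(dist u v)\<^sup>2 \<le> 4 * (d + e)\<^sup>2 - 4 * d\<^sup>2"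
      using parallelogram mid by linarith
    also have "\<dots> = 4 * (2 * d + e) * e"
      by (simp add: power2_eq_square algebra_simps)
    also have "\<dots> \<le> 4 * (2 * d + 1) * e"
      using e by (intro mult_right_mono) auto
    finally show ?thesis .
  qed
  obtain p where p: "\<And>n. p \<in> S n"
  proof (rule decreasing_closed_nest[of S])
    show "closed (S n)" for n
      unfolding S_def using \<open>closed C\<close> by (intro closed_Int closed_cball)
    show "S n \<noteq> {}" for n
    proof -
      have "\<exists>y\<in>C. dist z y < d + 1 / real (Suc n)"
        using cINF_less_iff[of C "dist z" "d + 1 / real (Suc n)"] \<open>C \<noteq> {}\<close>
        by (auto simp: d_def infdist_def)
      then show ?thesis
        unfolding S_def by force
    qed
    show "S n \<subseteq> S m" if "m \<le> n" for m n
    proof -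
      have "1 / real (Suc n) \<le> 1 / real (Suc m)"
        using that by (simp add: frac_le)
      then show ?thesis
        unfolding S_def by auto
    qed
    show "\<exists>n. \<forall>u\<in>S n. \<forall>v\<in>S n. dist u v < \<epsilon>" if "\<epsilon> > 0" for \<epsilon>
    proof -
      have c: "0 < 4 * (2 * d + 1)" using d0 by simp
      obtain n where n: "inverse (real (Suc n)) < \<epsilon>\<^sup>2 / (4 * (2 * d + 1))"
        using reals_Archimedean[of "\<epsilon>\<^sup>2 / (4 * (2 * d + 1))"] c \<open>\<epsilon> > 0\<close> by auto
      then have small: "4 * (2 * d + 1) * (1 / real (Suc n)) < \<epsilon>\<^sup>2"
        using c by (simp add: pos_less_divide_eq inverse_eq_divide mult.commute)
      have "dist u v < \<epsilon>" if "u \<in> S n" "v \<in> S n" for u v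
      proof -
        have "(dist u v)\<^sup>2 \<le> 4 * (2 * d + 1) * (1 / real (Suc n))"
          using that by (intro diam) (auto simp: S_def)
        then have "(dist u v)\<^sup>2 < \<epsilon>\<^sup>2" using small by linarith
        then show ?thesis
          using \<open>\<epsilon> > 0\<close> by (simp add: power2_less_imp_less)
      qed
      then show ?thesis by blast
    qed
  qed blast
  have "dist z p \<le> d"
  proof (rule field_le_epsilon)
    fix e :: real
    assume "0 < e"
    then obtain n where "inverse (real (Suc n)) < e"
      using reals_Archimedean by blast
    then show "dist z p \<le> d + e"
      using p[of n] by (simp add: S_def inverse_eq_divide)
  qed
  moreover have "p \<in> C" using p[of 0] by (simp add: S_def)
  ultimately show ?thesis using dle by (meson order_trans)
qed

lemma metric_proj_nearest:
  fixes C :: "'a::{real_inner, complete_space} set"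
  assumes "closed C" "convex C" "C \<noteq> {}"
  shows "metric_proj C z \<in> C \<and> (\<forall>y\<in>C. dist z (metric_proj C z) \<le> dist z y)"
proof -
  have "\<exists>!p. p \<in> C \<and> (\<forall>y\<in>C. dist z p \<le> dist z y)"
    using nearest_point_exists[OF assms] any_closest_point_unique[OF assms(2,1)] by blast
  then show ?thesis
    unfolding metric_proj_def by (rule theI')
qed

lemma metric_proj_obtuse_angle:
  fixes C :: "'a::{real_inner, complete_space} set"
  assumes "closed C" "convex C" "y \<in> C"
  shows "(z - metric_proj C z) \<bullet> (y - metric_proj C z) \<le> 0"
proof -
  have "metric_proj C z \<in> C \<and> (\<forall>y\<in>C. dist z (metric_proj C z) \<le> dist z y)"
    using assms by (intro metric_proj_nearest) auto
  then show ?thesis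
    using any_closest_point_dot[OF assms(2,1) _ assms(3)] by blast
qed

lemma metric_proj_pythagoras:
  fixes C :: "'a::{real_inner, complete_space} set"
  assumes "closed C" "convex C" "y \<in> C"
  shows "(norm (metric_proj C z - z))\<^sup>2 + (norm (y - metric_proj C z))\<^sup>2 \<le> (norm (y - z))\<^sup>2"
  using metric_proj_obtuse_angle[OF assms, of z]
  by (simp add: power2_norm_eq_inner inner_diff_left inner_diff_right inner_commute)

section \<open>Polyhedra and separating halfspaces\<close>

lemma feasible_eq_Inter: "feasible C = (\<Inter>(a, b)\<in>C. {x. a \<bullet> x \<le> b})"
  by (auto simp: feasible_def)

lemma closed_feasible: "closed (feasible C)"
  unfolding feasible_eq_Inter by (intro closed_INT) (auto simp: closed_halfspace_le)

lemma convex_feasible: "convex (feasible C)"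
  unfolding feasible_eq_Inter by (intro convex_INT) (auto simp: convex_halfspace_le)

text \<open>The bounding hyperplane of the halfspace is at the same distance from \<open>z\<close> as \<open>S\<close> is, so
  crossing it takes a step at least as long.\<close>

lemma infdist_le_dist_proj_halfspace:
  fixes S :: "'a::{real_inner, complete_space} set"
  assumes "closed S" "convex S" "S \<noteq> {}" and y: "y \<in> feasible {proj_constraint S z}"
  shows "infdist z S \<le> norm (y - z)"
proof -
  define p where "p = metric_proj S z"
  have "p \<in> S"
    unfolding p_def using metric_proj_nearest[OF assms(1-3)] by blast
  then have "infdist z S \<le> norm (z - p)"
    using infdist_le[of p S z] by (simp add: dist_norm)
  also have "norm (z - p) \<le> norm (y - z)"
  proof (cases "z = p")
    case False
    have "(z - p) \<bullet> y \<le> (z - p) \<bullet> p"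
      using y by (simp add: feasible_def proj_constraint_def p_def)
    then have "norm (z - p) * norm (z - p) \<le> (z - p) \<bullet> (z - y)"
      by (simp add: power2_norm_eq_inner inner_diff_right flip: power2_eq_square)
    also have "\<dots> \<le> norm (z - p) * norm (z - y)"
      by (rule norm_cauchy_schwarz)
    finally show ?thesis
      using False by (simp add: norm_minus_commute)
  qed simp
  finally show ?thesis .
qed

section \<open>Properties of a run\<close>

text \<open>All that the convergence argument needs from one iteration: \<open>D\<close> is the constraint set left by
  the aggregation and \<open>l\<close> the index of a most distant set. The next iterate is a projection onto
  the nonempty polyhedron of \<open>D\<close> and the new halfspaces, so it satisfies all of them.\<close>

lemma bap_run_stepE:
  fixes K :: "nat \<Rightarrow> 'a::{real_inner, complete_space} set"
  assumes "bap_run r K x0 x"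
  obtains D l where "l \<in> {1..r}"
    and "infdist (x i) (K l) = Max ((\<lambda>l. infdist (x i) (K l)) ` {1..r})"
    and "x i = metric_proj (feasible D) x0"
    and "x (Suc i) \<in> feasible D" and "x (Suc i) \<in> feasible {proj_constraint (K l) (x i)}"
proof -
  obtain C C' where "\<forall>i. aggregates_to (C i) (C' i) \<and>
             x i = metric_proj (feasible (C' i)) x0 \<and>
             (\<exists>L. L \<subseteq> {1..r} \<and>
                  (\<exists>l\<in>L. infdist (x i) (K l) = Max ((\<lambda>l. infdist (x i) (K l)) ` {1..r})) \<and>
                  C (Suc i) = C' i \<union> (\<lambda>l. proj_constraint (K l) (x i)) ` L) \<and>
             feasible (C (Suc i)) \<noteq> {} \<and>
             x (Suc i) = metric_proj (feasible (C (Suc i))) x0"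
    using assms unfolding bap_run_def by (elim exE conjE) rule
  note run = this[rule_format, of i]
  from run obtain L l where L: "L \<subseteq> {1..r}" "l \<in> L"
    and max: "infdist (x i) (K l) = Max ((\<lambda>l. infdist (x i) (K l)) ` {1..r})"
    and C: "C (Suc i) = C' i \<union> (\<lambda>l. proj_constraint (K l) (x i)) ` L"
    by (elim exE conjE bexE) rule
  have "x (Suc i) \<in> feasible (C (Suc i))"
    using run metric_proj_nearest[OF closed_feasible convex_feasible] by metis
  then have "x (Suc i) \<in> feasible (C' i)" "x (Suc i) \<in> feasible {proj_constraint (K l) (x i)}"
    using L(2) unfolding C by (auto simp: feasible_def)
  then show thesis
    using L max run by (intro that[of l "C' i"]) auto
qed

lemma bap_run_pythagoras:
  fixes K :: "nat \<Rightarrow> 'a::{real_inner, complete_space} set"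
  assumes "bap_run r K x0 x"
  shows "(norm (x i - x0))\<^sup>2 + (norm (x (Suc i) - x i))\<^sup>2 \<le> (norm (x (Suc i) - x0))\<^sup>2"
proof -
  obtain D where "x i = metric_proj (feasible D) x0" "x (Suc i) \<in> feasible D"
    using bap_run_stepE[OF assms, of i] by blast
  then show ?thesis
    using metric_proj_pythagoras[OF closed_feasible convex_feasible] by metis
qed

lemma bap_run_infdist_le_step:
  fixes K :: "nat \<Rightarrow> 'a::{real_inner, complete_space} set"
  assumes K: "\<forall>l\<in>{1..r}. K l \<noteq> {} \<and> closed (K l) \<and> convex (K l)"
    and run: "bap_run r K x0 x" and k: "k \<in> {1..r}"
  shows "infdist (x i) (K k) \<le> norm (x (Suc i) - x i)"
proof -
  obtain l where l: "l \<in> {1..r}"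
    and max: "infdist (x i) (K l) = Max ((\<lambda>l. infdist (x i) (K l)) ` {1..r})"
    and half: "x (Suc i) \<in> feasible {proj_constraint (K l) (x i)}"
    by (rule bap_run_stepE[OF run, of i])
  have "infdist (x i) (K k) \<le> infdist (x i) (K l)"
    unfolding max using k by (intro Max_ge) auto
  also have "\<dots> \<le> norm (x (Suc i) - x i)"
    using K l half by (intro infdist_le_dist_proj_halfspace) auto
  finally show ?thesis .
qed

text \<open>A step of length \<open>0\<close> would place the iterate at distance \<open>0\<close> from every \<open>K l\<close>.\<close>

lemma bap_run_norm_strict_mono:
  fixes K :: "nat \<Rightarrow> 'a::{real_inner, complete_space} set"
  assumes K: "\<forall>l\<in>{1..r}. K l \<noteq> {} \<and> closed (K l) \<and> convex (K l)"
    and empty: "(\<Inter>l\<in>{1..r}. K l) = {}" and run: "bap_run r K x0 x"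
  shows "strict_mono (\<lambda>i. norm (x i - x0))"
proof (subst strict_mono_Suc_iff, intro allI)
  fix i
  have "x (Suc i) \<noteq> x i"
  proof
    assume "x (Suc i) = x i"
    then have "infdist (x i) (K l) = 0" if "l \<in> {1..r}" for l
      using bap_run_infdist_le_step[OF K run that, of i] infdist_nonneg[of "x i" "K l"] by simp
    then have "x i \<in> (\<Inter>l\<in>{1..r}. K l)"
      using K in_closed_iff_infdist_zero by blast
    then show False using empty by blast
  qed
  then have "0 < (norm (x (Suc i) - x i))\<^sup>2" by simp
  then have "(norm (x i - x0))\<^sup>2 < (norm (x (Suc i) - x0))\<^sup>2"
    using bap_run_pythagoras[OF run, of i] by linarith
  then show "norm (x i - x0) < norm (x (Suc i) - x0)"
    by (rule power2_less_imp_less) simp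
qed

text \<open>Bounded iterates make the convergent sequence \<open>\<parallel>x i - x0\<parallel>\<^sup>2\<close> dominate the squared steps
  through its increments.\<close>

lemma bap_run_steps_tendsto_0:
  fixes K :: "nat \<Rightarrow> 'a::{real_inner, complete_space} set"
  assumes run: "bap_run r K x0 x" and bound: "\<And>i. norm (x i - x0) \<le> B"
  shows "(\<lambda>i. norm (x (Suc i) - x i)) \<longlonglongrightarrow> 0"
proof -
  define g where "g i = (norm (x i - x0))\<^sup>2" for i
  have step: "(norm (x (Suc i) - x i))\<^sup>2 \<le> g (Suc i) - g i" for i
    using bap_run_pythagoras[OF run, of i] by (simp add: g_def)
  have "incseq g"
    by (rule incseq_SucI) (metis step diff_ge_0_iff_ge order_trans zero_le_power2)
  moreover have "g i \<le> B\<^sup>2" for i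
    unfolding g_def using bound by (intro power_mono) auto
  ultimately obtain m where m: "g \<longlonglongrightarrow> m"
    using incseq_convergent by blast
  have "(\<lambda>i. g (Suc i) - g i) \<longlonglongrightarrow> m - m"
    by (intro tendsto_diff m LIMSEQ_Suc)
  then have "(\<lambda>i. g (Suc i) - g i) \<longlonglongrightarrow> 0" by simp
  then have "(\<lambda>i. (norm (x (Suc i) - x i))\<^sup>2) \<longlonglongrightarrow> 0"
    by (rule tendsto_sandwich[OF _ _ tendsto_const, rotated 2]) (auto simp: step)
  then show ?thesis
    by (simp add: power_tendsto_0_iff)
qed

text \<open>Infinitely many iterates near \<open>z\<close> bound the monotone norms, so the steps vanish; among these
  iterates there is then one that is close to \<open>z\<close> and also close to any given \<open>K l\<close>.\<close>

lemma bap_run_no_strong_cluster_point: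
  fixes K :: "nat \<Rightarrow> 'a::{real_inner, complete_space} set"
  assumes K: "\<forall>l\<in>{1..r}. K l \<noteq> {} \<and> closed (K l) \<and> convex (K l)"
    and empty: "(\<Inter>l\<in>{1..r}. K l) = {}" and run: "bap_run r K x0 x"
  shows "\<not> strong_cluster_point x z"
proof
  assume z: "strong_cluster_point x z"
  have near: "\<exists>\<^sub>F i in sequentially. dist z (x i) < e" if "0 < e" for e
    using z[unfolded strong_cluster_point_def, rule_format, of "ball z e"] that by simp
  have "norm (x i - x0) \<le> norm (z - x0) + 1" for i
  proof -
    obtain j where j: "i \<le> j" "dist z (x j) < 1"
      using near[of 1] unfolding frequently_sequentially by auto
    have "norm (x i - x0) \<le> norm (x j - x0)"
      using strict_mono_mono[OF bap_run_norm_strict_mono[OF K empty run]] j(1) by (rule monoD)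
    also have "\<dots> \<le> norm (z - x0) + dist z (x j)"
      using dist_triangle[of "x j" x0 z] by (simp add: dist_norm norm_minus_commute)
    finally show ?thesis using j(2) by linarith
  qed
  then have steps: "(\<lambda>i. norm (x (Suc i) - x i)) \<longlonglongrightarrow> 0"
    by (rule bap_run_steps_tendsto_0[OF run])
  have "z \<in> K l" if l: "l \<in> {1..r}" for l
  proof -
    have "infdist z (K l) \<le> 0"
    proof (rule field_le_epsilon)
      fix e :: real
      assume "0 < e"
      then have "\<forall>\<^sub>F i in sequentially. norm (x (Suc i) - x i) < e / 2"
        using order_tendstoD(2)[OF steps, of "e / 2"] by simp
      then obtain i where i: "dist z (x i) < e / 2" "norm (x (Suc i) - x i) < e / 2"
        using frequently_eventually_frequently[OF near[of "e / 2"]] \<open>0 < e\<close>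
        by (force dest: frequently_ex)
      then show "infdist z (K l) \<le> 0 + e"
        using infdist_triangle[of z "K l" "x i"] bap_run_infdist_le_step[OF K run l, of i]
        by linarith
    qed
    then have "infdist z (K l) = 0"
      using infdist_nonneg[of z "K l"] by linarith
    then show ?thesis
      using K l in_closed_iff_infdist_zero by blast
  qed
  then show False using empty by blast
qed

section \<open>Divergence in finite dimension\<close>

lemma bounded_imp_strong_cluster_point:
  fixes x :: "nat \<Rightarrow> 'a::{real_normed_vector, heine_borel}"
  assumes "bounded (range x)"
  shows "\<exists>z. strong_cluster_point x z"
proof -
  obtain z s where s: "strict_mono s" and lim: "(x \<circ> s) \<longlonglongrightarrow> z"
    using bounded_imp_convergent_subsequence[OF assms] by blast
  have "\<exists>\<^sub>F i in sequentially. x i \<in> U" if U: "open U" "z \<in> U" for U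
    unfolding frequently_sequentially
  proof
    fix N
    have "\<forall>\<^sub>F n in sequentially. x (s n) \<in> U"
      using topological_tendstoD[OF lim U] by simp
    then obtain M where "\<And>n. M \<le> n \<Longrightarrow> x (s n) \<in> U"
      unfolding eventually_sequentially by blast
    then have "x (s (max M N)) \<in> U" by simp
    moreover have "N \<le> s (max M N)"
      using seq_suble[OF s, of "max M N"] by simp
    ultimately show "\<exists>n\<ge>N. x n \<in> U" by blast
  qed
  then show ?thesis
    unfolding strong_cluster_point_def by blast
qed

lemma bap_run_norm_at_top:
  fixes K :: "nat \<Rightarrow> 'a::{real_inner, heine_borel, complete_space} set"
  assumes K: "\<forall>l\<in>{1..r}. K l \<noteq> {} \<and> closed (K l) \<and> convex (K l)"
    and empty: "(\<Inter>l\<in>{1..r}. K l) = {}" and run: "bap_run r K x0 x"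
  shows "filterlim (\<lambda>i. norm (x i - x0)) at_top sequentially"
proof -
  have mono: "mono (\<lambda>i. norm (x i - x0))"
    by (intro strict_mono_mono bap_run_norm_strict_mono[OF K empty run])
  have "\<exists>N. B \<le> norm (x N - x0)" for B
  proof (rule ccontr)
    assume "\<nexists>N. B \<le> norm (x N - x0)"
    then have "range x \<subseteq> ball x0 B"
      by (auto simp: dist_norm norm_minus_commute not_le)
    then have "bounded (range x)"
      by (rule bounded_subset[OF bounded_ball])
    then show False
      using bounded_imp_strong_cluster_point bap_run_no_strong_cluster_point[OF K empty run]
      by blast
  qed
  then show ?thesis
    unfolding filterlim_at_top eventually_sequentially
    using mono by (meson monoD order_trans)
qed

theorem theorem5p7:
  "(\<forall>(r::nat) (K :: nat \<Rightarrow> 'a::{real_inner, complete_space} set) (x0::'a) (x :: nat \<Rightarrow> 'a).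
      (\<forall>l\<in>{1..r}. K l \<noteq> {} \<and> closed (K l) \<and> convex (K l)) \<and>
      (\<Inter>l\<in>{1..r}. K l) = {} \<and>
      bap_run r K x0 x
      \<longrightarrow> \<not> (\<exists>z. strong_cluster_point x z))
   \<and>
   (\<forall>(r::nat) (K :: nat \<Rightarrow> (real ^ 'n) set) (x0 :: real ^ 'n) (x :: nat \<Rightarrow> real ^ 'n).
      (\<forall>l\<in>{1..r}. K l \<noteq> {} \<and> closed (K l) \<and> convex (K l)) \<and>
      (\<Inter>l\<in>{1..r}. K l) = {} \<and>
      bap_run r K x0 x
      \<longrightarrow> strict_mono (\<lambda>i. norm (x i - x0)) \<and>
          filterlim (\<lambda>i. norm (x i - x0)) at_top sequentially)"
proof (intro conjI allI impI, goal_cases)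
  case (1 r K x0 x)
  then show ?case using bap_run_no_strong_cluster_point by blast
next
  case (2 r K x0 x)
  then show ?case using bap_run_norm_strict_mono by blast
next
  case (3 r K x0 x)
  then show ?case using bap_run_norm_at_top by blast
qed

end
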